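(* Let $d\in\mathbb{N}$ and $\eta\in\mathbb{R}$ with $\eta\le 1/d$. Then $\lambda(\mathcal{D}(\eta))=\infty$ and $\lambda(\mathcal{D}(\eta)^c)=0$, where $\lambda$ is Lebesgue measure on $\mathbb{R}^d$.
   Context: For $\boldsymbol{\alpha}\in\mathbb{R}^d$ and $\eta\in\mathbb{R}$, the set of $\eta$-normalized approximations to $\boldsymbol{\alpha}$ is $\mathrm{NA}_\eta(\boldsymbol{\alpha})=\{|q|^{\eta}(q\boldsymbol{\alpha}-\boldsymbol{p}):q\in\mathbb{Z}\setminus\{0\},\ \boldsymbol{p}\in\mathbb{Z}^d\}$, and $\mathcal{A}_\eta(\boldsymbol{\alpha})$ denotes the set of all accumulation points of $\mathrm{NA}_\eta(\boldsymbol{\alpha})$ in $\mathbb{R}^d$. Define $\mathcal{D}(\eta)=\{\boldsymbol{\alpha}\in\mathbb{R}^d:\mathcal{A}_\eta(\boldsymbol{\alpha})=\mathbb{R}^d\}$, and $\mathcal{D}(\eta)^c=\mathbb{R}^d\setminus\mathcal{D}(\eta)$. *)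

theory Defs
  imports "HOL-Analysis.Analysis"
begin

definition NA :: "real \<Rightarrow> real^'n \<Rightarrow> (real^'n) set" where
  "NA \<eta> \<alpha> = {(\<bar>real_of_int q\<bar> powr \<eta>) *\<^sub>R (real_of_int q *\<^sub>R \<alpha> - p) | q p.
      q \<noteq> 0 \<and> (\<forall>i. p $ i \<in> \<int>)}"

definition accA :: "real \<Rightarrow> real^'n \<Rightarrow> (real^'n) set" where
  "accA \<eta> \<alpha> = {x. x islimpt NA \<eta> \<alpha>}"

definition DD :: "real \<Rightarrow> (real^'n) set" where
  "DD \<eta> = {\<alpha>. accA \<eta> \<alpha> = UNIV}"

end

theory Submission
  imports Defs
begin

text \<open>
  It suffices that, for every ball \<open>B(y, e)\<close>, almost every \<open>\<alpha>\<close> has a normalized approximation in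
  \<open>B(y, e)\<close>. For \<open>\<eta> < 0\<close> a single large \<open>q\<close> does. Let \<open>0 \<le> \<eta> \<le> 1/d\<close>, let \<open>M = N ^ d\<close> be large and
  \<open>\<rho> = M powr (- 1 - \<eta>)\<close>. By Dirichlet's theorem every \<open>\<alpha>\<close> has some \<open>q \<le> M\<close> with
  \<open>|q \<alpha> - p| < d / N\<close>, and those \<open>\<alpha>\<close> in a given ball \<open>U\<close> for which \<open>q \<le> \<delta> M\<close> occupy only a small
  proportion of \<open>U\<close>. Hence the points \<open>p / q\<close> with \<open>\<delta> M < q \<le> M\<close> are \<open>K \<rho>\<close>-dense in a fixed
  proportion of \<open>U\<close>, and by Vitali's covering lemma a fixed proportion of \<open>U\<close> is filled by
  disjoint balls \<open>B(p / q, K \<rho>)\<close>. If \<open>K\<close> is large in terms of \<open>y\<close> and \<open>e\<close>, each of them contains a ball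
  of radius \<open>e \<rho>\<close> all of whose points are approximated by \<open>p / q\<close> as desired. So the exceptional set has density
  bounded away from \<open>1\<close> in every small ball, which forces it to be null.
\<close>

section \<open>A density criterion for null sets\<close>

text \<open>A weak form of the Lebesgue density theorem. Take an open \<open>T\<close> barely larger
  than \<open>S\<close>; Vitali fills \<open>S\<close> up to a null set with disjoint balls inside
  \<open>T\<close>, each meeting \<open>S\<close> in proportion at most \<open>k\<close>. So
  \<mu>(S) \<le> k (\<mu>(S) + e) for all \<open>e > 0\<close>, and \<open>k < 1\<close> leaves only
  measure 0.\<close>

lemma negligible_if_density_bounded:
  fixes S :: "'a::euclidean_space set"
  assumes S: "S \<in> sets lebesgue" and k: "0 \<le> k" "k < 1"
    and dens: "\<And>x r. 0 < r \<Longrightarrow> r \<le> 1 \<Longrightarrow>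
      measure lebesgue (S \<inter> ball x r) \<le> k * measure lebesgue (ball x r)"
  shows "negligible S"
proof -
  let ?\<mu> = "measure lebesgue :: 'a set \<Rightarrow> real"
  \<comment> \<open>Truncation makes the measure finite, as the final cancellation requires.\<close>
  have "negligible (S \<inter> ball 0 (real R))" for R :: nat
  proof -
    let ?S = "S \<inter> ball 0 (real R)"
    have Sm: "?S \<in> lmeasurable"
      using S by (metis Int_commute fmeasurable_Int_fmeasurable lmeasurable_ball)
    have le: "?\<mu> ?S \<le> k * ?\<mu> ?S + e" if "e > 0" for e
    proof -
      obtain T where T: "open T" "?S \<subseteq> T" "T - ?S \<in> lmeasurable"
        "emeasure lebesgue (T - ?S) < ennreal e"
        using sets_lebesgue_outer_open[of ?S e] Sm \<open>e > 0\<close> by blast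
      have Teq: "T = ?S \<union> (T - ?S)" using T(2) by blast
      have Tm: "T \<in> lmeasurable"
        using Sm T(3) Teq by (metis fmeasurable.Un)
      have "?\<mu> (T - ?S) < e"
        using T(3,4) \<open>e > 0\<close> by (simp add: emeasure_eq_measure2 ennreal_less_iff)
      moreover have "?\<mu> T \<le> ?\<mu> ?S + ?\<mu> (T - ?S)"
        by (subst Teq) (intro measure_Un_le, use Sm T(3) in auto)
      ultimately have muT: "?\<mu> T \<le> ?\<mu> ?S + e" by simp
      let ?K = "{(x, r). 0 < r \<and> r \<le> 1 \<and> ball x r \<subseteq> T}"
      obtain C where C: "countable C" "C \<subseteq> ?K"
        and pw: "pairwise (\<lambda>i j. disjnt (ball (fst i) (snd i)) (ball (fst j) (snd j))) C"
        and neg: "negligible (?S - (\<Union>i\<in>C. ball (fst i) (snd i)))"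
      proof (rule Vitali_covering_theorem_balls[of ?S ?K fst snd])
        fix x and d :: real
        assume x: "x \<in> ?S" and d: "0 < d"
        then obtain s where s: "s > 0" "ball x s \<subseteq> T"
          using T openE by (metis subsetD)
        let ?r = "min (min s (d / 2)) 1"
        have "ball x ?r \<subseteq> T" using s by (meson subset_ball min.cobounded1 order_trans)
        then show "\<exists>i. i \<in> ?K \<and> x \<in> ball (fst i) (snd i) \<and> snd i < d"
          using s d by (intro exI[of _ "(x, ?r)"]) auto
      qed
      let ?U = "\<lambda>i. ?S \<inter> ball (fst i) (snd i)"
      \<comment> \<open>A bound uniform over finite subfamilies passes to the countable union.
        Disjointness turns the sum of ball measures into the measure of a subset of
        \<open>T\<close>.\<close>
      have fin: "?\<mu> (\<Union>i\<in>I. ?U i) \<le> k * ?\<mu> T" if I: "I \<subseteq> C" "finite I" for I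
      proof -
        have "?\<mu> (\<Union>i\<in>I. ?U i) \<le> (\<Sum>i\<in>I. ?\<mu> (?U i))"
          using I Sm by (intro measure_UNION_le) auto
        also have "\<dots> \<le> (\<Sum>i\<in>I. k * ?\<mu> (ball (fst i) (snd i)))"
        proof (rule sum_mono)
          fix i assume "i \<in> I"
          then have i: "0 < snd i" "snd i \<le> 1" using I C by auto
          have "?\<mu> (?U i) \<le> ?\<mu> (S \<inter> ball (fst i) (snd i))"
            using S Sm by (intro measure_mono_fmeasurable) (auto intro: fmeasurable_Int_fmeasurable simp: Int_commute[of S])
          also have "\<dots> \<le> k * ?\<mu> (ball (fst i) (snd i))" using dens i by blast
          finally show "?\<mu> (?U i) \<le> k * ?\<mu> (ball (fst i) (snd i))" .
        qed
        also have "\<dots> = k * ?\<mu> (\<Union>i\<in>I. ball (fst i) (snd i))"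
          using I pw by (subst measure_UNION') (auto simp: sum_distrib_left elim: pairwise_mono)
        also have "\<dots> \<le> k * ?\<mu> T"
          using I C Tm k by (intro mult_left_mono measure_mono_fmeasurable) (fastforce simp: sets.finite_UN)+
        finally show ?thesis .
      qed
      have U: "?U i \<in> lmeasurable" if "i \<in> C" for i
        using Sm by (rule fmeasurable.Int) auto
      have Um: "(\<Union>i\<in>C. ?U i) \<in> lmeasurable"
        by (rule fmeasurable_UN_bound[OF C(1) U fin])
      have Ule: "?\<mu> (\<Union>i\<in>C. ?U i) \<le> k * ?\<mu> T"
        by (rule measure_UN_bound[OF C(1) U fin])
      have "?\<mu> ?S = ?\<mu> (\<Union>i\<in>C. ?U i)"
        by (rule measure_negligible_symdiff[OF Um]) (rule negligible_subset[OF neg], auto)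
      also have "\<dots> \<le> k * (?\<mu> ?S + e)"
        using Ule muT k by (meson mult_left_mono order_trans)
      also have "\<dots> \<le> k * ?\<mu> ?S + e"
        using k \<open>e > 0\<close> by (simp add: distrib_left mult_left_le_one_le)
      finally show ?thesis .
    qed
    have "?\<mu> ?S \<le> k * ?\<mu> ?S"
      using le by (rule field_le_epsilon)
    then have "(1 - k) * ?\<mu> ?S \<le> 0" by (simp add: algebra_simps)
    then have "?\<mu> ?S = 0"
      using k by (metis diff_gt_0_iff_gt measure_nonneg mult_le_0_iff linorder_not_le order_antisym)
    then show ?thesis using Sm by (simp add: negligible_iff_measure)
  qed
  then have "negligible (\<Union>R::nat. S \<inter> ball 0 (real R))"
    by (intro negligible_countable_Union) auto
  moreover have "S \<subseteq> (\<Union>R::nat. S \<inter> ball 0 (real R))"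
    using reals_Archimedean2 by fastforce
  ultimately show ?thesis by (rule negligible_subset)
qed

section \<open>Dirichlet approximation and the points with small denominators\<close>

text \<open>Simultaneous Dirichlet approximation, with the coordinates enumerated by
  \<open>h\<close>. Passing from a bound 1/N per coordinate to the Euclidean norm through the l1
  norm costs the factor \<open>CARD('n)\<close>.\<close>

lemma Dirichlet_approx_vec:
  fixes \<alpha> :: "real^'n" and N :: nat
  assumes "N > 0"
  obtains q :: nat and p :: "real^'n" where "0 < q" "q \<le> N ^ CARD('n)" "\<And>i. p $ i \<in> \<int>"
    "norm (real q *\<^sub>R \<alpha> - p) < real CARD('n) / real N"
proof -
  obtain h :: "'n \<Rightarrow> nat" where h: "bij_betw h UNIV {0..<CARD('n)}"
    using ex_bij_betw_finite_nat[of "UNIV :: 'n set"] by auto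
  define g where "g = inv_into UNIV h"
  have g: "g (h i) = i" for i
    using h by (simp add: g_def bij_betw_def)
  have hlt: "h i < CARD('n)" for i using h by (auto simp: bij_betw_def)
  obtain q p where q: "0 < q" "q \<le> int (N ^ CARD('n))"
    and p: "\<And>i. i < CARD('n) \<Longrightarrow> \<bar>of_int q * \<alpha> $ (g i) - of_int (p i)\<bar> < 1 / N"
    using Dirichlet_approx_simult[OF assms, where n = "CARD('n)" and \<theta> = "\<lambda>i. \<alpha> $ (g i)"] by metis
  let ?p = "(\<chi> i. real_of_int (p (h i))) :: real^'n"
  have "norm (real (nat q) *\<^sub>R \<alpha> - ?p) \<le> (\<Sum>i\<in>UNIV. \<bar>(real (nat q) *\<^sub>R \<alpha> - ?p) $ i\<bar>)"
    by (rule norm_le_l1_cart)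
  also have "\<dots> < (\<Sum>i\<in>(UNIV::'n set). 1 / real N)"
    using p[OF hlt] g q by (intro sum_strict_mono) auto
  also have "\<dots> = real CARD('n) / real N" by simp
  finally show ?thesis using q by (intro that[of "nat q" ?p]) (auto simp: nat_le_iff)
qed

text \<open>The ball lies in a cube, and each side of length 2R contains at most 2R + 1
  integers.\<close>

lemma integer_points_ball:
  fixes z :: "real^'n" and R :: real
  assumes "R \<ge> 0"
  defines "P \<equiv> {p. (\<forall>i. p $ i \<in> \<int>) \<and> norm (p - z) < R}"
  shows "finite P" "real (card P) \<le> (2 * R + 1) ^ CARD('n)"
proof -
  let ?A = "\<lambda>i. {\<lceil>z $ i - R\<rceil>..\<lfloor>z $ i + R\<rfloor>}"
  let ?F = "PiE (UNIV :: 'n set) ?A"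
  let ?v = "\<lambda>f. (\<chi> i. real_of_int (f i)) :: real^'n"
  have "p \<in> ?v ` ?F" if "p \<in> P" for p
  proof
    show "p = ?v (\<lambda>i. \<lfloor>p $ i\<rfloor>)"
      using that by (auto simp: P_def vec_eq_iff)
    have "\<lfloor>p $ i\<rfloor> \<in> ?A i" for i
    proof -
      have "\<bar>p $ i - z $ i\<bar> < R"
        using that component_le_norm_cart[of "p - z" i] by (auto simp: P_def)
      moreover have "real_of_int \<lfloor>p $ i\<rfloor> = p $ i" using that by (auto simp: P_def)
      ultimately have "z $ i - R \<le> real_of_int \<lfloor>p $ i\<rfloor>" "real_of_int \<lfloor>p $ i\<rfloor> \<le> z $ i + R"
        by linarith+
      then show ?thesis unfolding atLeastAtMost_iff by (metis ceiling_le le_floor_iff)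
    qed
    then show "(\<lambda>i. \<lfloor>p $ i\<rfloor>) \<in> ?F" by auto
  qed
  then have sub: "P \<subseteq> ?v ` ?F" by blast
  have finF: "finite ?F" by (intro finite_PiE) auto
  show "finite P" using sub finF finite_subset by blast
  have "card P \<le> card ?F"
    using sub finF by (meson card_image_le card_mono finite_imageI order_trans)
  also have "card ?F = (\<Prod>i\<in>UNIV. card (?A i))" by (simp add: card_PiE)
  finally have "real (card P) \<le> (\<Prod>i\<in>UNIV. real (card (?A i)))"
    by (metis of_nat_le_iff of_nat_prod)
  also have "\<dots> \<le> (\<Prod>i\<in>(UNIV::'n set). 2 * R + 1)"
  proof (rule prod_mono, safe)
    fix i
    have "real_of_int (\<lfloor>z $ i + R\<rfloor> + 1 - \<lceil>z $ i - R\<rceil>) \<le> 2 * R + 1"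
      by (smt (verit) le_of_int_ceiling of_int_1 of_int_add of_int_diff of_int_floor_le)
    then show "real (card (?A i)) \<le> 2 * R + 1" using assms by auto
  qed simp
  also have "\<dots> = (2 * R + 1) ^ CARD('n)" by simp
  finally show "real (card P) \<le> (2 * R + 1) ^ CARD('n)" .
qed

text \<open>\<open>W\<close> is the union of the balls of radius t/q about p/q, with t = d/N and q
  \<le> Q. For each \<open>q\<close> at most (qr + 3)^d numerators matter, so these balls have total
  measure at most v t^d (r + 3/q)^d. The last power is at most (4r)^d when q > 1/r, and at most 4^d
  for the at most 1/r remaining values of \<open>q\<close>.\<close>

lemma small_denominators_cover:
  fixes x :: "real^'n" and r Q :: real and N :: nat
  defines "d \<equiv> CARD('n)"
  assumes r: "0 < r" "r \<le> 1" and N: "real d \<le> real N" and Q: "0 \<le> Q"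
  obtains W where "W \<in> lmeasurable"
    "measure lebesgue W \<le>
       unit_ball_vol (real d) * (real d / real N) ^ d * (Q * (4 * r) ^ d + 4 ^ d / r)"
    "\<And>\<alpha> q p. \<alpha> \<in> ball x (r / 2) \<Longrightarrow> 0 < q \<Longrightarrow> real q \<le> Q \<Longrightarrow> \<forall>i. p $ i \<in> \<int> \<Longrightarrow>
       norm (real q *\<^sub>R \<alpha> - p) < real d / real N \<Longrightarrow> \<alpha> \<in> W"
proof -
  let ?\<mu> = "measure lebesgue :: (real^'n) set \<Rightarrow> real"
  define v where "v = unit_ball_vol (real d)"
  have v: "v \<ge> 0" by (simp add: v_def)
  have d: "d > 0" by (simp add: d_def)
  then have N0: "N > 0" using N by linarith
  define t where "t = real d / real N"
  have t: "0 < t" "t \<le> 1" using d N0 N by (auto simp: t_def)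
  \<comment> \<open>The radius comes from |p - qx| \<le> q |\<alpha> - x| + |q\<alpha> - p| with
    \<alpha> in the half ball.\<close>
  define P :: "nat \<Rightarrow> (real^'n) set"
    where "P q = {p. (\<forall>i. p $ i \<in> \<int>) \<and> norm (p - real q *\<^sub>R x) < real q * r / 2 + t}" for q
  define W where "W = (\<Union>q\<in>{1..nat \<lfloor>Q\<rfloor>}. \<Union>p\<in>P q. ball ((1 / real q) *\<^sub>R p) (t / real q))"
  have finP: "finite (P q)" and cardP: "real (card (P q)) \<le> (real q * r + 3) ^ d" for q
  proof -
    have nn: "0 \<le> real q * r / 2 + t" using r t by simp
    show "finite (P q)" unfolding P_def using nn by (rule integer_points_ball)
    have "real (card (P q)) \<le> (2 * (real q * r / 2 + t) + 1) ^ d"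
      unfolding P_def d_def using nn by (rule integer_points_ball)
    also have "\<dots> \<le> (real q * r + 3) ^ d"
      using r t by (intro power_mono) auto
    finally show "real (card (P q)) \<le> (real q * r + 3) ^ d" .
  qed
  show ?thesis
  proof (rule that)
    show "W \<in> lmeasurable"
      unfolding W_def using finP by (intro fmeasurable.finite_UN) auto
    have inner: "?\<mu> (\<Union>p\<in>P q. ball ((1 / real q) *\<^sub>R p) (t / real q))
        \<le> v * t ^ d * ((4 * r) ^ d + (if real q \<le> 1 / r then 4 ^ d else 0))"
      if q: "q \<ge> 1" for q
    proof -
      have "?\<mu> (\<Union>p\<in>P q. ball ((1 / real q) *\<^sub>R p) (t / real q))
          \<le> (\<Sum>p\<in>P q. ?\<mu> (ball ((1 / real q) *\<^sub>R p) (t / real q)))"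
        using finP by (intro measure_UNION_le) auto
      also have "\<dots> = real (card (P q)) * (v * (t / real q) ^ d)"
        using t by (simp add: content_ball v_def d_def)
      also have "\<dots> \<le> (real q * r + 3) ^ d * (v * (t / real q) ^ d)"
        using cardP v t by (intro mult_right_mono) auto
      also have "\<dots> = v * t ^ d * (r + 3 / real q) ^ d"
      proof -
        have "(r + 3 / real q) = (real q * r + 3) / real q"
          using q by (simp add: field_simps)
        then show ?thesis by (simp add: power_divide)
      qed
      also have "(r + 3 / real q) ^ d \<le> (4 * r) ^ d + (if real q \<le> 1 / r then 4 ^ d else 0)"
      proof (cases "real q \<le> 1 / r")
        case True
        have "3 / real q \<le> 3" using q by (simp add: field_simps)
        then have "(r + 3 / real q) ^ d \<le> 4 ^ d"
          using r by (intro power_mono) auto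
        then show ?thesis using True r by (simp add: add_increasing)
      next
        case False
        then have "3 / real q \<le> 3 * r" using q r by (simp add: field_simps)
        then have "(r + 3 / real q) ^ d \<le> (4 * r) ^ d"
          using r by (intro power_mono) auto
        then show ?thesis using False by simp
      qed
      finally show ?thesis using v t by (simp add: mult_left_mono)
    qed
    have "?\<mu> W \<le> (\<Sum>q\<in>{1..nat \<lfloor>Q\<rfloor>}. ?\<mu> (\<Union>p\<in>P q. ball ((1 / real q) *\<^sub>R p) (t / real q)))"
      unfolding W_def using finP by (intro measure_UNION_le) (auto intro!: sets.finite_UN)
    also have "\<dots> \<le> (\<Sum>q\<in>{1..nat \<lfloor>Q\<rfloor>}. v * t ^ d * ((4 * r) ^ d + (if real q \<le> 1 / r then 4 ^ d else 0)))"
      using inner by (intro sum_mono) auto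
    also have "\<dots> = v * t ^ d * (real (nat \<lfloor>Q\<rfloor>) * (4 * r) ^ d
        + (\<Sum>q\<in>{1..nat \<lfloor>Q\<rfloor>}. if real q \<le> 1 / r then 4 ^ d else 0))"
      by (simp add: sum_distrib_left[symmetric] sum.distrib)
    also have "\<dots> \<le> v * t ^ d * (Q * (4 * r) ^ d + 4 ^ d / r)"
    proof (intro mult_left_mono add_mono mult_right_mono)
      show "real (nat \<lfloor>Q\<rfloor>) \<le> Q" using Q by simp
      have "(\<Sum>q\<in>{1..nat \<lfloor>Q\<rfloor>}. if real q \<le> 1 / r then (4::real) ^ d else 0)
          = real (card ({1..nat \<lfloor>Q\<rfloor>} \<inter> {q. real q \<le> 1 / r})) * 4 ^ d"
        by (simp add: sum.If_cases)
      also have "\<dots> \<le> (1 / r) * 4 ^ d"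
      proof (rule mult_right_mono)
        have "{1..nat \<lfloor>Q\<rfloor>} \<inter> {q. real q \<le> 1 / r} \<subseteq> {1..nat \<lfloor>1 / r\<rfloor>}"
          by (auto simp: le_nat_floor)
        then have "card ({1..nat \<lfloor>Q\<rfloor>} \<inter> {q. real q \<le> 1 / r}) \<le> nat \<lfloor>1 / r\<rfloor>"
          using card_mono[of "{1..nat \<lfloor>1 / r\<rfloor>}"] by simp
        also have "real (nat \<lfloor>1 / r\<rfloor>) \<le> 1 / r" using r by simp
        finally show "real (card ({1..nat \<lfloor>Q\<rfloor>} \<inter> {q. real q \<le> 1 / r})) \<le> 1 / r" by simp
      qed simp
      finally show "(\<Sum>q\<in>{1..nat \<lfloor>Q\<rfloor>}. if real q \<le> 1 / r then (4::real) ^ d else 0) \<le> 4 ^ d / r"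
        by simp
    qed (use v t r in auto)
    finally show "?\<mu> W \<le> unit_ball_vol (real d) * (real d / real N) ^ d * (Q * (4 * r) ^ d + 4 ^ d / r)"
      by (simp add: v_def t_def)
  next
    fix \<alpha> :: "real^'n" and q :: nat and p :: "real^'n"
    assume \<alpha>: "\<alpha> \<in> ball x (r / 2)" and q: "0 < q" "real q \<le> Q" and p: "\<forall>i. p $ i \<in> \<int>"
      and ap: "norm (real q *\<^sub>R \<alpha> - p) < real d / real N"
    have "norm (p - real q *\<^sub>R x) = norm (real q *\<^sub>R (\<alpha> - x) - (real q *\<^sub>R \<alpha> - p))"
      by (simp add: scaleR_right_diff_distrib)
    also have "\<dots> \<le> norm (real q *\<^sub>R (\<alpha> - x)) + norm (real q *\<^sub>R \<alpha> - p)"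
      by (rule norm_triangle_ineq4)
    also have "norm (real q *\<^sub>R (\<alpha> - x)) < real q * (r / 2)"
      using \<alpha> q by (simp add: dist_norm norm_minus_commute)
    finally have "p \<in> P q" using p ap by (simp add: P_def t_def)
    moreover have "\<alpha> \<in> ball ((1 / real q) *\<^sub>R p) (t / real q)"
    proof -
      have "(1 / real q) *\<^sub>R p - \<alpha> = - ((1 / real q) *\<^sub>R (real q *\<^sub>R \<alpha> - p))"
        using q by (simp add: scaleR_right_diff_distrib)
      then have "norm ((1 / real q) *\<^sub>R p - \<alpha>) = norm (real q *\<^sub>R \<alpha> - p) / real q"
        using q by simp
      then show ?thesis using ap q by (simp add: dist_norm t_def divide_strict_right_mono del: divide_divide_eq_left)
    qed
    moreover have "q \<in> {1..nat \<lfloor>Q\<rfloor>}" using q by (auto simp: le_nat_floor)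
    ultimately show "\<alpha> \<in> W" unfolding W_def by blast
  qed
qed

section \<open>Parameters with an approximation in a prescribed set\<close>

text \<open>Lying in \<open>hit_set \<eta> U\<close> for all nonempty open \<open>U\<close> means
  that \<open>NA \<eta> \<alpha>\<close> is dense, so the task is to show that each complement is
  null.\<close>

definition hit_set :: "real \<Rightarrow> (real^'n) set \<Rightarrow> (real^'n) set" where
  "hit_set \<eta> U = {\<alpha>. NA \<eta> \<alpha> \<inter> U \<noteq> {}}"

lemma open_hit_set:
  fixes U :: "(real^'n) set"
  assumes "open U"
  shows "open (hit_set \<eta> U)"
proof -
  have "hit_set \<eta> U = (\<Union>q\<in>-{0}. \<Union>p\<in>{p. \<forall>i. p $ i \<in> \<int>}.
      (\<lambda>\<alpha>. (\<bar>real_of_int q\<bar> powr \<eta>) *\<^sub>R (real_of_int q *\<^sub>R \<alpha> - p)) -` U)"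
    unfolding hit_set_def NA_def by auto
  moreover have "open ((\<lambda>\<alpha>::real^'n. (\<bar>real_of_int q\<bar> powr \<eta>) *\<^sub>R (real_of_int q *\<^sub>R \<alpha> - p)) -` U)" for q p
    by (intro open_vimage assms continuous_intros)
  ultimately show ?thesis by (simp add: open_UN)
qed

text \<open>For fixed \<open>q\<close> and \<open>p\<close> the map sending \<alpha> to q^\<eta>
  (q\<alpha> - p) is a similarity of ratio 1/w taking p/q + w y to \<open>y\<close>, so it takes the
  given ball onto \<open>ball y e\<close>.\<close>

lemma ball_subset_hit_set:
  fixes p y :: "real^'n" and q :: nat and \<eta> e :: real
  assumes q: "0 < q" and p: "\<forall>i. p $ i \<in> \<int>"
  defines "w \<equiv> real q powr (- 1 - \<eta>)"
  shows "ball ((1 / real q) *\<^sub>R p + w *\<^sub>R y) (e * w) \<subseteq> hit_set \<eta> (ball y e)"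
proof
  fix \<alpha> assume \<alpha>: "\<alpha> \<in> ball ((1 / real q) *\<^sub>R p + w *\<^sub>R y) (e * w)"
  have w: "w > 0" using q by (simp add: w_def)
  have qw: "real q powr \<eta> * w = 1 / real q"
    using q by (simp add: w_def powr_add[symmetric] powr_minus_divide)
  let ?z = "(real q powr \<eta>) *\<^sub>R (real q *\<^sub>R \<alpha> - p)"
  have eq: "w *\<^sub>R (y - ?z) = ((1 / real q) *\<^sub>R p + w *\<^sub>R y) - \<alpha>"
  proof -
    have "w *\<^sub>R ?z = (1 / real q) *\<^sub>R (real q *\<^sub>R \<alpha> - p)"
      using qw by (simp add: mult.commute)
    also have "\<dots> = \<alpha> - (1 / real q) *\<^sub>R p"
      using q by (simp add: scaleR_right_diff_distrib)
    finally show ?thesis by (simp add: scaleR_right_diff_distrib)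
  qed
  have "w * norm (y - ?z) = norm (w *\<^sub>R (y - ?z))" using w by simp
  also have "\<dots> < e * w" using \<alpha> by (simp add: eq dist_norm)
  finally have "?z \<in> ball y e" using w by (simp add: dist_norm mult.commute)
  moreover have "?z \<in> NA \<eta> \<alpha>"
    unfolding NA_def using q p by (intro CollectI exI[of _ "int q"] exI[of _ p]) auto
  ultimately show "\<alpha> \<in> hit_set \<eta> (ball y e)" unfolding hit_set_def by blast
qed

text \<open>The factor q^\<eta> tends to 0, so for one large \<open>q\<close> the scaled integer
  lattice is finer than \<open>e\<close> and rounding suffices.\<close>

lemma hit_set_neg_exponent:
  fixes y :: "real^'n"
  assumes "\<eta> < 0" "e > 0"
  shows "hit_set \<eta> (ball y e) = UNIV"
proof -
  have "\<alpha> \<in> hit_set \<eta> (ball y e)" for \<alpha> :: "real^'n"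
  proof -
    have "((\<lambda>q. real q powr \<eta>) \<longlongrightarrow> 0) sequentially"
      using assms by (intro tendsto_neg_powr filterlim_real_sequentially)
    then have "\<forall>\<^sub>F q in sequentially. real q powr \<eta> < e / real CARD('n)"
      by (rule order_tendstoD) (use assms in simp)
    then have "\<forall>\<^sub>F q in sequentially. real q powr \<eta> < e / real CARD('n) \<and> q > 0"
      using eventually_gt_at_top by (rule eventually_conj)
    then obtain q :: nat where q: "real q powr \<eta> < e / real CARD('n)" "q > 0"
      using eventually_happens by fastforce
    define s where "s = real q powr \<eta>"
    have s: "s > 0" using q by (simp add: s_def)
    \<comment> \<open>The value of \<open>p\<close> that would give exactly \<open>y\<close>; it is
      rounded down coordinatewise.\<close>
    let ?z = "real q *\<^sub>R \<alpha> - (1 / s) *\<^sub>R y"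
    define p :: "real^'n" where "p = (\<chi> i. real_of_int \<lfloor>?z $ i\<rfloor>)"
    have "norm (?z - p) \<le> (\<Sum>i\<in>UNIV. \<bar>(?z - p) $ i\<bar>)" by (rule norm_le_l1_cart)
    also have "\<dots> \<le> (\<Sum>i\<in>(UNIV::'n set). 1)"
    proof (rule sum_mono)
      fix i
      have "(?z - p) $ i = ?z $ i - real_of_int \<lfloor>?z $ i\<rfloor>" by (simp add: p_def)
      then show "\<bar>(?z - p) $ i\<bar> \<le> 1" by linarith
    qed
    finally have zp: "norm (?z - p) \<le> real CARD('n)" by simp
    have "norm (s *\<^sub>R (real q *\<^sub>R \<alpha> - p) - y) = s * norm (?z - p)"
    proof -
      have "s *\<^sub>R (real q *\<^sub>R \<alpha> - p) - y = s *\<^sub>R (?z - p)"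
        using s by (simp add: scaleR_right_diff_distrib)
      then show ?thesis using s by simp
    qed
    also have "\<dots> \<le> s * real CARD('n)" using zp s by (intro mult_left_mono) auto
    also have "\<dots> < e" using q by (simp add: s_def field_simps)
    finally have "s *\<^sub>R (real q *\<^sub>R \<alpha> - p) \<in> ball y e"
      by (simp add: dist_norm norm_minus_commute)
    moreover have "s *\<^sub>R (real q *\<^sub>R \<alpha> - p) \<in> NA \<eta> \<alpha>"
      unfolding NA_def s_def using q by (intro CollectI exI[of _ "int q"] exI[of _ p]) (auto simp: p_def)
    ultimately show ?thesis unfolding hit_set_def by blast
  qed
  then show ?thesis by blast
qed

section \<open>Lower bound for the local density of the hit set\<close>

text \<open>What matters is that \<open>k\<close> does not depend on \<open>x\<close> and
  \<open>r\<close>, as the density criterion demands. Only \<open>N\<close>, and with it M and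
  \<rho>, is chosen after the ball; \<rho> cancels in the final ratio.\<close>

lemma hit_set_local_density:
  fixes y :: "real^'n"
  assumes \<eta>: "0 \<le> \<eta>" "\<eta> \<le> 1 / real CARD('n)" and e: "e > 0"
  obtains k where "0 \<le> k" "k < 1"
    "\<And>x r. 0 < r \<Longrightarrow> r \<le> 1 \<Longrightarrow>
      measure lebesgue (- hit_set \<eta> (ball y e) \<inter> ball x r) \<le> k * measure lebesgue (ball x r)"
proof -
  let ?\<mu> = "measure lebesgue :: (real^'n) set \<Rightarrow> real"
  define d where "d = CARD('n)"
  define v where "v = unit_ball_vol (real d)"
  \<comment> \<open>Chosen so that (4d)^d * 2\<delta> = 1 / 2^(d+1): then \<open>W\<close> takes up
    at most half of \<open>ball x (r / 2)\<close>.\<close>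
  define \<delta> where "\<delta> = 1 / (4 * (8 * real d) ^ d)"
  \<comment> \<open>The first summand makes the balls about p/q cover; the second leaves room for
    the shift w y and the radius e \<rho>, as w \<le> \<rho> / \<delta>^2.\<close>
  define K where "K = real d / \<delta> + (norm y + e) / \<delta>\<^sup>2"
  \<comment> \<open>Half of the half ball gives 1 / 2^(d+1), Vitali enlargement costs 5^d, and
    shrinking radius K \<rho> to e \<rho> costs (K/e)^d.\<close>
  define c where "c = (e / (5 * K)) ^ d / 2 ^ (d + 1)"
  have d: "d > 0" by (simp add: d_def)
  have v: "v > 0" by (simp add: v_def)
  have \<mu>_ball: "measure lborel (ball z s) = v * s ^ d" if "s \<ge> 0" for z :: "real^'n" and s
    using that by (simp add: content_ball v_def d_def)
  have "1 \<le> (8 * real d) ^ d" using d by (intro one_le_power) auto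
  then have \<delta>: "0 < \<delta>" "\<delta> \<le> 1" by (auto simp: \<delta>_def divide_simps)
  have \<delta>2: "0 < \<delta>\<^sup>2" "\<delta>\<^sup>2 \<le> 1" using \<delta> by (auto simp: power_le_one)
  have "0 \<le> real d / \<delta>" using \<delta> by simp
  moreover have "e \<le> (norm y + e) / \<delta>\<^sup>2"
  proof -
    have "e * \<delta>\<^sup>2 \<le> e * 1" using \<delta>2 e by (intro mult_left_mono) auto
    also have "\<dots> \<le> norm y + e" by simp
    finally show ?thesis using \<delta>2 by (simp add: pos_le_divide_eq)
  qed
  ultimately have Ke: "e \<le> K" by (simp add: K_def)
  then have K: "K > 0" using e by simp
  have c: "0 < c" "c \<le> 1"
  proof -
    show "0 < c" using e K by (simp add: c_def)
    have "(e / (5 * K)) ^ d \<le> 1"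
      using e K Ke by (intro power_le_one) (auto simp: divide_simps)
    also have "(1::real) \<le> 2 ^ (d + 1)" by (rule one_le_power) simp
    finally show "c \<le> 1" unfolding c_def by (subst divide_le_eq_1_pos) auto
  qed
  have H: "hit_set \<eta> (ball y e) \<inter> ball x r \<in> lmeasurable" for x r
    using open_hit_set[of "ball y e" \<eta>] by (intro lmeasurable_open bounded_Int disjI2 open_Int) auto
  have hit_large: "?\<mu> (hit_set \<eta> (ball y e) \<inter> ball x r) \<ge> c * ?\<mu> (ball x r)"
    if r: "0 < r" "r \<le> 1" for x r
  proof -
    \<comment> \<open>The three bounds serve, in order, the covering lemma, the control of the term
      4^d / r in the measure of \<open>W\<close>, and K \<rho> \<le> r/4.\<close>
    obtain N :: nat where N: "max (real d) (max (1 / (\<delta> * r ^ (d + 1))) (4 * K / r)) \<le> real N"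
      using real_arch_simple by blast
    have Nd: "real d \<le> real N" and N1: "1 / (\<delta> * r ^ (d + 1)) \<le> real N" and N2: "4 * K / r \<le> real N"
      using N by auto
    have N0: "N \<ge> 1" using Nd d by linarith
    define M where "M = real N ^ d"
    have MN: "real N \<le> M"
      unfolding M_def using N0 d by (intro self_le_power) auto
    have M1: "M \<ge> 1" using MN N0 by linarith
    define \<rho> where "\<rho> = M powr (- 1 - \<eta>)"
    have \<rho>0: "\<rho> > 0" using M1 by (simp add: \<rho>_def)
    have "\<rho> \<le> M powr (- 1)" unfolding \<rho>_def using M1 \<eta> by (intro powr_mono) auto
    also have "\<dots> = 1 / M" using M1 by (simp add: powr_minus_divide)
    finally have "\<rho> \<le> 1 / M" .
    also have "\<dots> \<le> 1 / (4 * K / r)"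
      using N2 MN M1 K r by (intro divide_left_mono) auto
    finally have "\<rho> * (4 * K) \<le> r" using K r by (simp add: field_simps)
    then have K\<rho>r: "2 * (K * \<rho>) \<le> r / 2" by (simp add: algebra_simps)
    \<comment> \<open>The critical exponent enters here: N = M^(1/d), so the left side is
      M^(-1-1/d), and \<eta> \<le> 1/d compares it with M^(-1-\<eta>).\<close>
    have \<rho>N: "1 / (M * real N) \<le> \<rho>"
    proof -
      have "real N = M powr (1 / real d)"
        using N0 d by (simp add: M_def powr_realpow[symmetric] powr_powr)
      then have "M * real N = M powr (1 + 1 / real d)"
        using M1 by (simp add: powr_add)
      then have "1 / (M * real N) = M powr (- (1 + 1 / real d))"
        using M1 by (simp only: powr_minus_divide)
      also have "\<dots> \<le> \<rho>" unfolding \<rho>_def using M1 \<eta> by (intro powr_mono) (auto simp: d_def)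
      finally show ?thesis .
    qed
    have Q0: "0 \<le> \<delta> * M" using \<delta> M1 by simp
    obtain W where W: "W \<in> lmeasurable"
      and \<mu>W: "?\<mu> W \<le> v * (real d / real N) ^ d * ((\<delta> * M) * (4 * r) ^ d + 4 ^ d / r)"
      and Wcov: "\<And>\<alpha> q p. \<alpha> \<in> ball x (r / 2) \<Longrightarrow> 0 < q \<Longrightarrow> real q \<le> \<delta> * M \<Longrightarrow> \<forall>i. p $ i \<in> \<int> \<Longrightarrow>
         norm (real q *\<^sub>R \<alpha> - p) < real d / real N \<Longrightarrow> \<alpha> \<in> W"
      by (rule small_denominators_cover[OF r, where x = x, folded d_def, folded v_def, OF Nd Q0]) blast
    have \<mu>W': "?\<mu> W \<le> v * r ^ d / 2 ^ (d + 1)"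
    proof -
      have 8: "(8 * real d) ^ d = 1 / (4 * \<delta>)" by (simp add: \<delta>_def)
      have 4: "(4 * real d) ^ d = 1 / (4 * \<delta> * 2 ^ d)"
      proof -
        have "(4 * real d) ^ d = (8 * real d) ^ d / 2 ^ d"
          by (subst power_divide[symmetric]) simp
        then show ?thesis unfolding 8 by simp
      qed
      \<comment> \<open>Since M = N^d, the outer factor is d^d / M, which cancels \<open>M\<close>
        in the first term and makes the second small.\<close>
      have "(real d / real N) ^ d * ((\<delta> * M) * (4 * r) ^ d + 4 ^ d / r)
          = (4 * real d) ^ d * (\<delta> * r ^ d + 1 / (r * M))"
        using M1 r by (simp add: M_def[symmetric] power_divide power_mult_distrib field_simps)
      also have "\<dots> \<le> (4 * real d) ^ d * (\<delta> * r ^ d + \<delta> * r ^ d)"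
      proof (intro mult_left_mono add_mono order_refl)
        have "1 / (\<delta> * r ^ (d + 1)) \<le> M" using N1 MN by linarith
        then show "1 / (r * M) \<le> \<delta> * r ^ d" using M1 r \<delta> by (simp add: field_simps)
      qed (use \<delta> in auto)
      also have "\<dots> = r ^ d / 2 ^ (d + 1)" unfolding 4 using \<delta> by (simp add: field_simps)
      finally have "v * ((real d / real N) ^ d * ((\<delta> * M) * (4 * r) ^ d + 4 ^ d / r)) \<le> v * (r ^ d / 2 ^ (d + 1))"
        using v by (intro mult_left_mono) auto
      then show ?thesis using \<mu>W by (simp add: mult.assoc)
    qed
    \<comment> \<open>The last condition makes \<open>I\<close> finite and keeps the balls inside
      \<open>ball x r\<close>; it loses no fraction within K \<rho> of the half ball.\<close>
    define I where "I = {(q, p). 0 < q \<and> q \<le> N ^ d \<and> \<delta> * M < real q \<and> (\<forall>i. p $ i \<in> \<int>) \<and>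
        norm ((1 / real q) *\<^sub>R p - x) < r / 2 + K * \<rho>}"
    define a :: "nat \<times> (real^'n) \<Rightarrow> real^'n" where "a = (\<lambda>(q, p). (1 / real q) *\<^sub>R p)"
    have finI: "finite I"
    proof (rule finite_subset)
      let ?P = "\<lambda>q. {p. (\<forall>i. p $ i \<in> \<int>) \<and> norm (p - real q *\<^sub>R x) < real q * (r / 2 + K * \<rho>)}"
      show "finite (SIGMA q:{0..N ^ d}. ?P q)"
        using r K \<rho>0 by (intro finite_SigmaI integer_points_ball) auto
      show "I \<subseteq> (SIGMA q:{0..N ^ d}. ?P q)"
      proof
        fix i assume "i \<in> I"
        then obtain q p where i: "i = (q, p)" and qp: "0 < q" "q \<le> N ^ d" "\<forall>i. p $ i \<in> \<int>"
          "norm ((1 / real q) *\<^sub>R p - x) < r / 2 + K * \<rho>" by (auto simp: I_def)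
        have "p - real q *\<^sub>R x = real q *\<^sub>R ((1 / real q) *\<^sub>R p - x)"
          using qp by (simp add: scaleR_right_diff_distrib)
        then have "norm (p - real q *\<^sub>R x) = real q * norm ((1 / real q) *\<^sub>R p - x)"
          by simp
        also have "\<dots> < real q * (r / 2 + K * \<rho>)" using qp by (intro mult_strict_left_mono) auto
        finally show "i \<in> (SIGMA q:{0..N ^ d}. ?P q)" using i qp by auto
      qed
    qed
    have cover: "ball x (r / 2) - W \<subseteq> (\<Union>i\<in>I. ball (a i) (K * \<rho>))"
    proof
      fix \<alpha> assume \<alpha>: "\<alpha> \<in> ball x (r / 2) - W"
      obtain q :: nat and p :: "real^'n" where q: "0 < q" "q \<le> N ^ d" and p: "\<And>i. p $ i \<in> \<int>"
        and ap: "norm (real q *\<^sub>R \<alpha> - p) < real d / real N"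
        using Dirichlet_approx_vec[of N \<alpha>] N0 unfolding d_def by auto
      \<comment> \<open>A smaller denominator would put \<alpha> in \<open>W\<close>.\<close>
      have q\<delta>: "\<delta> * M < real q"
        using Wcov[of \<alpha> q p] \<alpha> q p ap by force
      have "(1 / real q) *\<^sub>R p - \<alpha> = - ((1 / real q) *\<^sub>R (real q *\<^sub>R \<alpha> - p))"
        using q by (simp add: scaleR_right_diff_distrib)
      then have "norm ((1 / real q) *\<^sub>R p - \<alpha>) = norm (real q *\<^sub>R \<alpha> - p) / real q"
        using q by simp
      also have "\<dots> < (real d / real N) / real q"
        using ap q by (intro divide_strict_right_mono) auto
      also have "\<dots> \<le> (real d / real N) / (\<delta> * M)"
        using q q\<delta> \<delta> M1 by (intro divide_left_mono mult_pos_pos) auto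
      also have "\<dots> = (real d / \<delta>) * (1 / (M * real N))" by simp
      also have "\<dots> \<le> (real d / \<delta>) * \<rho>" using \<rho>N \<delta> by (intro mult_left_mono) auto
      also have "\<dots> \<le> K * \<rho>"
        using \<rho>0 e \<delta> by (intro mult_right_mono) (auto simp: K_def)
      finally have 1: "norm ((1 / real q) *\<^sub>R p - \<alpha>) < K * \<rho>" .
      have "norm ((1 / real q) *\<^sub>R p - x) \<le> norm ((1 / real q) *\<^sub>R p - \<alpha>) + norm (\<alpha> - x)"
        by (metis diff_add_cancel add_diff_eq norm_triangle_ineq)
      then have "norm ((1 / real q) *\<^sub>R p - x) < r / 2 + K * \<rho>"
        using 1 \<alpha> by (simp add: dist_norm norm_minus_commute)
      then have "(q, p) \<in> I" using q p q\<delta> by (auto simp: I_def)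
      moreover have "\<alpha> \<in> ball (a (q, p)) (K * \<rho>)" using 1 by (simp add: a_def dist_norm)
      ultimately show "\<alpha> \<in> (\<Union>i\<in>I. ball (a i) (K * \<rho>))" by blast
    qed
    obtain C where CI: "C \<subseteq> I"
      and pw: "pairwise (\<lambda>i j. disjnt (ball (a i) (K * \<rho>)) (ball (a j) (K * \<rho>))) C"
      and Ccov: "ball x (r / 2) - W \<subseteq> (\<Union>i\<in>C. ball (a i) (5 * (K * \<rho>)))"
      using Vitali_covering_lemma_balls[OF cover, of "K * \<rho>"] K \<rho>0 by (metis mult_pos_pos order_refl)
    have finC: "finite C" using CI finI finite_subset by blast
    \<comment> \<open>The half of the half ball outside \<open>W\<close> is covered by
      \<open>card C\<close> enlarged balls.\<close>
    have card: "r ^ d / 2 ^ (d + 1) \<le> real (card C) * (5 * (K * \<rho>)) ^ d"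
    proof -
      have "v * (r / 2) ^ d = ?\<mu> (ball x (r / 2))" using r by (simp add: \<mu>_ball)
      also have "\<dots> \<le> ?\<mu> (W \<union> (\<Union>i\<in>C. ball (a i) (5 * (K * \<rho>))))"
        using Ccov W finC by (intro measure_mono_fmeasurable fmeasurable.Un fmeasurable.finite_UN) auto
      also have "\<dots> \<le> ?\<mu> W + ?\<mu> (\<Union>i\<in>C. ball (a i) (5 * (K * \<rho>)))"
        using W finC by (intro measure_Un_le) auto
      also have "?\<mu> (\<Union>i\<in>C. ball (a i) (5 * (K * \<rho>))) \<le> (\<Sum>i\<in>C. ?\<mu> (ball (a i) (5 * (K * \<rho>))))"
        using finC by (intro measure_UNION_le) auto
      also have "\<dots> = real (card C) * (v * (5 * (K * \<rho>)) ^ d)"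
        using K \<rho>0 by (simp add: \<mu>_ball)
      finally have "v * (r / 2) ^ d \<le> v * r ^ d / 2 ^ (d + 1) + real (card C) * (v * (5 * (K * \<rho>)) ^ d)"
        using \<mu>W' by linarith
      moreover have "v * (r / 2) ^ d = 2 * (v * r ^ d / 2 ^ (d + 1))" by (simp add: power_divide)
      ultimately have "v * r ^ d / 2 ^ (d + 1) \<le> real (card C) * (v * (5 * (K * \<rho>)) ^ d)"
        by (simp only: mult_2 add_le_cancel_left)
      then have "v * (r ^ d / 2 ^ (d + 1)) \<le> v * (real (card C) * (5 * (K * \<rho>)) ^ d)"
        by (simp add: mult.left_commute)
      then show ?thesis using v by (rule mult_left_le_imp_le)
    qed
    define b :: "nat \<times> (real^'n) \<Rightarrow> real^'n"
      where "b i = a i + (real (fst i) powr (- 1 - \<eta>)) *\<^sub>R y" for i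
    \<comment> \<open>The first inclusion transfers disjointness from the selected balls; the second
      places the small balls in the set to be measured.\<close>
    have b: "ball (b i) (e * \<rho>) \<subseteq> ball (a i) (K * \<rho>)"
      "ball (b i) (e * \<rho>) \<subseteq> hit_set \<eta> (ball y e) \<inter> ball x r" if "i \<in> C" for i
    proof -
      obtain q p where i: "i = (q, p)" by (cases i)
      have qp: "0 < q" "q \<le> N ^ d" "\<delta> * M < real q" "\<forall>i. p $ i \<in> \<int>"
        "norm ((1 / real q) *\<^sub>R p - x) < r / 2 + K * \<rho>"
        using that CI i by (auto simp: I_def)
      define w where "w = real q powr (- 1 - \<eta>)"
      have w\<rho>: "\<rho> \<le> w"
      proof -
        have "real q \<le> M" using qp(2) by (simp add: M_def flip: of_nat_power)
        then show ?thesis unfolding \<rho>_def w_def using qp \<eta> by (intro powr_mono2') auto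
      qed
      \<comment> \<open>Large denominators keep \<open>w\<close> comparable to \<rho>; \<eta> \<le>
        1 replaces the power of \<delta> by one free of \<eta>.\<close>
      have "w \<le> (\<delta> * M) powr (- 1 - \<eta>)"
        unfolding w_def using qp \<eta> \<delta> M1 by (intro powr_mono2') auto
      also have "\<dots> = \<delta> powr (- 1 - \<eta>) * \<rho>" using \<delta> M1 by (simp add: powr_mult \<rho>_def)
      also have "\<delta> powr (- 1 - \<eta>) \<le> \<delta> powr (- 2)"
      proof (rule powr_mono')
        have "1 / real CARD('n) \<le> 1" by simp
        then show "- 2 \<le> - 1 - \<eta>" using \<eta> by linarith
      qed (use \<delta> in auto)
      also have "\<delta> powr (- 2) = 1 / \<delta>\<^sup>2" using \<delta> by (simp add: powr_minus_divide)
      finally have w: "w \<le> \<rho> / \<delta>\<^sup>2" using \<rho>0 by simp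
      have w0: "w > 0" using qp by (simp add: w_def)
      have "e * \<rho> * \<delta>\<^sup>2 \<le> e * \<rho> * 1" using e \<rho>0 \<delta>2 by (intro mult_left_mono) auto
      then have "e * \<rho> \<le> e * \<rho> / \<delta>\<^sup>2" using \<delta>2 by (simp add: pos_le_divide_eq)
      moreover have "norm (w *\<^sub>R y) \<le> \<rho> / \<delta>\<^sup>2 * norm y"
        using mult_right_mono[OF w norm_ge_zero[of y]] w0 by simp
      moreover have "(norm y + e) / \<delta>\<^sup>2 * \<rho> = \<rho> / \<delta>\<^sup>2 * norm y + e * \<rho> / \<delta>\<^sup>2"
        by (simp add: algebra_simps add_divide_distrib)
      ultimately have "norm (w *\<^sub>R y) + e * \<rho> \<le> (norm y + e) / \<delta>\<^sup>2 * \<rho>"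
        by (simp only: add_mono)
      also have "\<dots> \<le> K * \<rho>" using \<rho>0 \<delta> by (intro mult_right_mono) (auto simp: K_def)
      finally have nw: "norm (w *\<^sub>R y) + e * \<rho> \<le> K * \<rho>" .
      have bi: "b i = a i + w *\<^sub>R y" by (simp add: b_def i w_def)
      then show ba: "ball (b i) (e * \<rho>) \<subseteq> ball (a i) (K * \<rho>)"
        using nw by (simp add: ball_subset_ball_iff dist_norm)
      have "dist (a i) x < r / 2 + K * \<rho>" using qp by (simp add: a_def i dist_norm)
      then have "ball (a i) (K * \<rho>) \<subseteq> ball x r"
        using K\<rho>r by (simp add: ball_subset_ball_iff)
      \<comment> \<open>Using the common radius e \<rho>, legitimate as q \<le> M, gives all small
        balls equal measure.\<close>
      moreover have "ball (b i) (e * \<rho>) \<subseteq> ball (b i) (e * w)"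
        using e w\<rho> by (intro subset_ball mult_left_mono) auto
      moreover have "ball (b i) (e * w) \<subseteq> hit_set \<eta> (ball y e)"
        using ball_subset_hit_set[OF qp(1,4), of \<eta> y e] by (simp add: b_def w_def a_def i)
      ultimately show "ball (b i) (e * \<rho>) \<subseteq> hit_set \<eta> (ball y e) \<inter> ball x r"
        using ba by blast
    qed
    have "c * ?\<mu> (ball x r) = v * (e / (5 * K)) ^ d * (r ^ d / 2 ^ (d + 1))"
      using r by (simp add: \<mu>_ball c_def)
    also have "\<dots> \<le> v * (e / (5 * K)) ^ d * (real (card C) * (5 * (K * \<rho>)) ^ d)"
      using card v e K by (intro mult_left_mono) auto
    also have "\<dots> = real (card C) * (v * (e * \<rho>) ^ d)"
      using K by (simp add: power_divide power_mult_distrib)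
    also have "\<dots> = (\<Sum>i\<in>C. ?\<mu> (ball (b i) (e * \<rho>)))"
      using e \<rho>0 by (simp add: \<mu>_ball)
    also have "\<dots> = ?\<mu> (\<Union>i\<in>C. ball (b i) (e * \<rho>))"
    proof (rule measure_UNION'[symmetric, OF finC])
      show "pairwise (\<lambda>i j. disjnt (ball (b i) (e * \<rho>)) (ball (b j) (e * \<rho>))) C"
        using pw b(1) unfolding pairwise_def disjnt_def by blast
    qed auto
    also have "\<dots> \<le> ?\<mu> (hit_set \<eta> (ball y e) \<inter> ball x r)"
      using b(2) finC H by (intro measure_mono_fmeasurable UN_least) auto
    finally show ?thesis .
  qed
  show ?thesis
  proof (rule that)
    show "0 \<le> 1 - c" "1 - c < 1" using c by auto
    fix x :: "real^'n" and r :: real assume r: "0 < r" "r \<le> 1"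
    let ?H = "hit_set \<eta> (ball y e) \<inter> ball x r"
    have "?\<mu> (- hit_set \<eta> (ball y e) \<inter> ball x r) = ?\<mu> (ball x r - ?H)"
      by (rule arg_cong[of _ _ ?\<mu>]) auto
    also have "\<dots> = ?\<mu> (ball x r) - ?\<mu> ?H"
      using H by (intro measurable_measure_Diff) auto
    also have "\<dots> \<le> (1 - c) * ?\<mu> (ball x r)"
      using hit_large[OF r, of x] by (simp add: algebra_simps)
    finally show "?\<mu> (- hit_set \<eta> (ball y e) \<inter> ball x r) \<le> (1 - c) * ?\<mu> (ball x r)" .
  qed
qed

section \<open>Null complements and passage to accumulation points\<close>

lemma negligible_compl_hit_set:
  fixes y :: "real^'n"
  assumes "\<eta> \<le> 1 / real CARD('n)" "e > 0"
  shows "negligible (- hit_set \<eta> (ball y e))"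
proof (cases "\<eta> < 0")
  case True
  then show ?thesis using assms by (simp add: hit_set_neg_exponent)
next
  case False
  then obtain k where k: "0 \<le> k" "k < 1"
    "\<And>x r. 0 < r \<Longrightarrow> r \<le> 1 \<Longrightarrow>
      measure lebesgue (- hit_set \<eta> (ball y e) \<inter> ball x r) \<le> k * measure lebesgue (ball x r)"
    using hit_set_local_density[of \<eta> e y] assms by (metis linorder_not_le)
  have "- hit_set \<eta> (ball y e) \<in> sets lebesgue"
    using open_hit_set[of "ball y e" \<eta>] by (intro borel_closed closed_Compl sets_completionI_sets) auto
  then show ?thesis using k by (rule negligible_if_density_bounded)
qed

theorem theorem1:
  fixes \<eta> :: real
  assumes "\<eta> \<le> 1 / real CARD('n::finite)"
  shows "emeasure lebesgue (DD \<eta> :: (real^'n) set) = \<infinity>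
         \<and> emeasure lebesgue (- (DD \<eta> :: (real^'n) set)) = 0"
proof -
  obtain \<B> :: "(real^'n) set set" where \<B>: "countable \<B>" "topological_basis \<B>"
    using ex_countable_basis by blast
  \<comment> \<open>A countable basis reduces density of \<open>NA \<eta> \<alpha>\<close> to
    countably many null exceptional sets.\<close>
  define X where "X = (\<Union>U\<in>\<B> - {{}}. - hit_set \<eta> U)"
  have "negligible (- hit_set \<eta> U)" if U: "U \<in> \<B> - {{}}" for U :: "(real^'n) set"
  proof -
    have "open U" using U \<B> topological_basis_open by blast
    moreover obtain y where "y \<in> U" using U by blast
    ultimately obtain e where "e > 0" "ball y e \<subseteq> U" by (rule openE)
    then have "- hit_set \<eta> U \<subseteq> - hit_set \<eta> (ball y e)" by (auto simp: hit_set_def)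
    then show ?thesis
      using negligible_compl_hit_set[OF assms \<open>e > 0\<close>] negligible_subset by blast
  qed
  then have X: "negligible X"
    unfolding X_def using \<B>(1) by (intro negligible_countable_Union) auto
  have "- DD \<eta> \<subseteq> X"
  proof (rule subsetI, rule ccontr)
    fix \<alpha> assume \<alpha>: "\<alpha> \<in> - DD \<eta>" "\<alpha> \<notin> X"
    have "z islimpt NA \<eta> \<alpha>" for z
    proof (rule islimptI)
      fix T :: "(real^'n) set" assume T: "z \<in> T" "open T"
      \<comment> \<open>A limit point needs an approximation different from \<open>z\<close>, so the
        basic set is sought inside \<open>T - {z}\<close>, which is open and nonempty because
        singletons are not open.\<close>
      then have "T \<noteq> {z}" using not_open_singleton by blast
      then obtain u where "u \<in> T - {z}" using T by blast
      moreover have "open (T - {z})" using T by (intro open_Diff) auto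
      ultimately obtain U where "U \<in> \<B>" "u \<in> U" "U \<subseteq> T - {z}"
        using topological_basisE[OF \<B>(2)] by metis
      then have "\<alpha> \<in> hit_set \<eta> U" using \<alpha>(2) by (auto simp: X_def)
      then show "\<exists>y\<in>NA \<eta> \<alpha>. y \<in> T \<and> y \<noteq> z"
        using \<open>U \<subseteq> T - {z}\<close> by (auto simp: hit_set_def)
    qed
    then show False using \<alpha>(1) by (auto simp: DD_def accA_def)
  qed
  then have null: "- DD \<eta> \<in> null_sets (lebesgue :: (real^'n) measure)"
    using X negligible_subset negligible_iff_null_sets by blast
  then have "emeasure lebesgue (UNIV - - DD \<eta> :: (real^'n) set) = emeasure lebesgue (UNIV :: (real^'n) set)"
    by (intro emeasure_Diff_null_set) auto
  then show ?thesis using null by (auto simp: Compl_eq_Diff_UNIV[symmetric])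
qed

end
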